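(* Consider a general setting of $n\ge2$ users with non-identical parameters $a_i,b_i$ and a fixed price $p$ among all users, in the model described in the context. Exposing exactly two connected users, without loss of generality users $1$ and $2$, to the peer effect (with strength $\gamma$) reduces the sum of their consumptions, compared with the sum $\frac{a_1-p}{2b_1}+\frac{a_2-p}{2b_2}$ of their consumptions without peer effect, under the following conditions: $$b_1\le\frac{(a_1-p)\left[4(b_2+\gamma)-\gamma w_{12}w_{21}\right]}{4(b_2+\gamma)\sum_{j=3}^nw_{1j}x_j+2w_{12}\big(a_2-p+\gamma\sum_{j=3}^nw_{2j}x_j\big)},$$ $$b_2\le\frac{(a_2-p)\left[4(b_1+\gamma)-\gamma w_{12}w_{21}\right]}{4(b_1+\gamma)\sum_{j=3}^nw_{2j}x_j+2w_{21}\big(a_1-p+\gamma\sum_{j=3}^nw_{1j}x_j\big)},$$ where $x_j=(a_j-p)/(2b_j)$ for $j\in\{3,\dots,n\}$. For the special case $n=2$, this condition reads $$b_1\le\frac{(a_1-p)(4b_2+3\gamma)}{2(a_2-p)}\quad\text{and}\quad b_2\le\frac{(a_2-p)(4b_1+3\gamma)}{2(a_1-p)}.$$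
   Context: The interaction matrix $W=(w_{ij})\in\mathbb R^{n\times n}$ has entries in $[0,1]$, zero diagonal and all row sums equal to $1$; $w_{ij}$ is the strength of influence of user $j$ on user $i$, and each $w_{ij}>0$ corresponds to a directed edge of the network from $j$ to $i$. User $i$ facing price $p$ chooses $x_i\ge0$ to maximize $a_ix_i-b_ix_i^2-px_i+\gamma_ix_i\big(\sum_kw_{ik}x_k-x_i\big)$. Standing assumption: $a_i>p$ and $b_i>\gamma_i$ for all $i$. A user exposed to the peer effect has $\gamma_i=\gamma$ and an unexposed user has $\gamma_i=0$; so here $\gamma_1=\gamma_2=\gamma$ and $\gamma_j=0$ for $j\ge3$. Consumptions are those of the Nash equilibrium, $x_i^\ast=\frac{a_i-p+\gamma_i\sum_kw_{ik}x_k^\ast}{2(b_i+\gamma_i)}$ for all $i$; in particular an unexposed user consumes $(a_i-p)/(2b_i)$. Empty sums are zero.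
   Formalization: The peer strength γ is taken nonnegative; "reduces" is proved as "does not increase", and as a strict decrease when γ>0 and either n=2 or at least one condition is strict; if both conditions are equalities (possible for n≥3) the sum is unchanged. *)

theory Defs
  imports Complex_Main
begin

text \<open>Users are the numbers \<open>1, \<dots>, n\<close>; values of \<open>W\<close>, \<open>a\<close>, \<open>b\<close>, \<open>g\<close> and \<open>x\<close> at other indices are
  irrelevant. \<open>W i j\<close> is the influence of user \<open>j\<close> on user \<open>i\<close>.\<close>

definition interaction_matrix :: "nat \<Rightarrow> (nat \<Rightarrow> nat \<Rightarrow> real) \<Rightarrow> bool" where
  "interaction_matrix n W \<longleftrightarrow>
     (\<forall>i\<in>{1..n}. \<forall>j\<in>{1..n}. 0 \<le> W i j \<and> W i j \<le> 1) \<and>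
     (\<forall>i\<in>{1..n}. W i i = 0) \<and>
     (\<forall>i\<in>{1..n}. (\<Sum>j=1..n. W i j) = 1)"

text \<open>There is an edge from \<open>j\<close> to \<open>i\<close> iff \<open>W i j > 0\<close>. Two users count as connected if there is an
  edge between them in at least one direction.\<close>

definition connected_users :: "(nat \<Rightarrow> nat \<Rightarrow> real) \<Rightarrow> nat \<Rightarrow> nat \<Rightarrow> bool" where
  "connected_users W i j \<longleftrightarrow> W i j > 0 \<or> W j i > 0"

definition exposure :: "nat set \<Rightarrow> real \<Rightarrow> nat \<Rightarrow> real" where
  "exposure S \<gamma> i = (if i \<in> S then \<gamma> else 0)"

definition utility ::
  "nat \<Rightarrow> (nat \<Rightarrow> nat \<Rightarrow> real) \<Rightarrow> (nat \<Rightarrow> real) \<Rightarrow> (nat \<Rightarrow> real) \<Rightarrow> real \<Rightarrow> (nat \<Rightarrow> real)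
    \<Rightarrow> (nat \<Rightarrow> real) \<Rightarrow> nat \<Rightarrow> real" where
  "utility n W a b p g x i =
     a i * x i - b i * (x i)\<^sup>2 - p * x i + g i * x i * ((\<Sum>k=1..n. W i k * x k) - x i)"

definition nash_equilibrium ::
  "nat \<Rightarrow> (nat \<Rightarrow> nat \<Rightarrow> real) \<Rightarrow> (nat \<Rightarrow> real) \<Rightarrow> (nat \<Rightarrow> real) \<Rightarrow> real \<Rightarrow> (nat \<Rightarrow> real)
    \<Rightarrow> (nat \<Rightarrow> real) \<Rightarrow> bool" where
  "nash_equilibrium n W a b p g x \<longleftrightarrow>
     (\<forall>i\<in>{1..n}. x i \<ge> 0 \<and>
        (\<forall>y\<ge>0. utility n W a b p g (x(i := y)) i \<le> utility n W a b p g x i))"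

text \<open>The consumption of an unexposed user, which does not depend on the other users.\<close>

definition unexposed_consumption ::
  "(nat \<Rightarrow> real) \<Rightarrow> (nat \<Rightarrow> real) \<Rightarrow> real \<Rightarrow> nat \<Rightarrow> real" where
  "unexposed_consumption a b p i = (a i - p) / (2 * b i)"

text \<open>The bound imposed on \<open>b i\<close> when \<open>{i, k} = {1, 2}\<close> are the exposed users, so that the unexposed
  ones are \<open>3, \<dots>, n\<close>.\<close>

definition exposure_bound ::
  "nat \<Rightarrow> (nat \<Rightarrow> nat \<Rightarrow> real) \<Rightarrow> (nat \<Rightarrow> real) \<Rightarrow> (nat \<Rightarrow> real) \<Rightarrow> real \<Rightarrow> real
    \<Rightarrow> nat \<Rightarrow> nat \<Rightarrow> real" where
  "exposure_bound n W a b p \<gamma> i k =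
     (a i - p) * (4 * (b k + \<gamma>) - \<gamma> * W i k * W k i) /
     (4 * (b k + \<gamma>) * (\<Sum>j=3..n. W i j * unexposed_consumption a b p j)
       + 2 * W i k * (a k - p + \<gamma> * (\<Sum>j=3..n. W k j * unexposed_consumption a b p j)))"

end

theory Submission
  imports Defs
begin

text \<open>Write \<open>A i = a i - p\<close>, let \<open>S i\<close> be the influence of the unexposed users on user \<open>i\<close>, and let
  \<open>{i, k} = {1, 2}\<close>. The first-order conditions of the two exposed users form a linear system with
  determinant \<open>D = 4 (b i + \<gamma>) (b k + \<gamma>) - \<gamma>\<^sup>2 W i k W k i > 0\<close>, and eliminating \<open>x k\<close> gives
  \<open>D (A i - 2 b i x i) = \<gamma> (N - b i E)\<close>, where \<open>N / E\<close> is the bound imposed on \<open>b i\<close>. So for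
  \<open>\<gamma> > 0\<close> each of the two conditions is equivalent to the exposed user consuming no more than without
  peer effect, with strictness corresponding to strictness. For \<open>n = 2\<close> the two conditions
  cannot both be equalities.\<close>

text \<open>Since \<open>0 \<le> c\<close>, the vertex \<open>c / (2 * d)\<close> is an admissible
  competitor. It beats \<open>x\<close> by a square over \<open>4 * d\<close>, so maximality forces
  that square to vanish.\<close>

lemma quadratic_argmax_nonneg:
  fixes c d x :: real
  assumes "0 < d" "0 \<le> c" and max: "\<And>y. 0 \<le> y \<Longrightarrow> c * y - d * y\<^sup>2 \<le> c * x - d * x\<^sup>2"
  shows "2 * d * x = c"
proof -
  have "c * (c / (2 * d)) - d * (c / (2 * d))\<^sup>2 \<le> c * x - d * x\<^sup>2"
    using assms by (intro max) simp
  moreover have "c * (c / (2 * d)) - d * (c / (2 * d))\<^sup>2 - (c * x - d * x\<^sup>2)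
      = (2 * d * x - c)\<^sup>2 / (4 * d)"
    using \<open>0 < d\<close> by (simp add: field_simps power2_eq_square)
  ultimately have "(2 * d * x - c)\<^sup>2 / (4 * d) \<le> 0"
    by linarith
  then have "(2 * d * x - c)\<^sup>2 \<le> 0"
    using \<open>0 < d\<close> by (simp add: divide_le_0_iff)
  then show ?thesis
    by simp
qed

text \<open>With a zero diagonal the peer sum ignores user i's own consumption, so a unilateral
  deviation faces a concave quadratic in \<open>y\<close> with fixed coefficients.\<close>

lemma utility_fun_upd:
  assumes "W i i = 0"
  shows "utility n W a b p g (x(i := y)) i =
    (a i - p + g i * (\<Sum>k=1..n. W i k * x k)) * y - (b i + g i) * y\<^sup>2"
proof -
  have "(\<Sum>k=1..n. W i k * (x(i := y)) k) = (\<Sum>k=1..n. W i k * x k)"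
    using assms by (intro sum.cong) auto
  then show ?thesis
    by (simp add: utility_def power2_eq_square algebra_simps)
qed

lemma nash_equilibrium_consumption:
  assumes W: "interaction_matrix n W" and nash: "nash_equilibrium n W a b p g x"
    and i: "i \<in> {1..n}" and "p \<le> a i" "0 \<le> g i" "0 < b i + g i"
  shows "2 * (b i + g i) * x i = a i - p + g i * (\<Sum>k=1..n. W i k * x k)"
proof (rule quadratic_argmax_nonneg)
  have Wii: "W i i = 0"
    using W i by (simp add: interaction_matrix_def)
  have "0 \<le> (\<Sum>k=1..n. W i k * x k)"
    using W nash i by (intro sum_nonneg mult_nonneg_nonneg)
      (auto simp: interaction_matrix_def nash_equilibrium_def)
  then show "0 \<le> a i - p + g i * (\<Sum>k=1..n. W i k * x k)"
    using assms by simp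
  show "(a i - p + g i * (\<Sum>k=1..n. W i k * x k)) * y - (b i + g i) * y\<^sup>2
      \<le> (a i - p + g i * (\<Sum>k=1..n. W i k * x k)) * x i - (b i + g i) * (x i)\<^sup>2"
    if "0 \<le> y" for y
  proof -
    \<comment> \<open>The equilibrium value is written with the trivial update
      \<open>x(i := x i)\<close> so that one rewrite rule turns both sides into quadratics.\<close>
    have "utility n W a b p g (x(i := y)) i \<le> utility n W a b p g (x(i := x i)) i"
      using nash i that by (simp add: nash_equilibrium_def)
    then show ?thesis
      unfolding utility_fun_upd[of W i, OF Wii] .
  qed
qed fact

lemma unexposed_equilibrium_consumption:
  assumes "interaction_matrix n W" "nash_equilibrium n W a b p g x"
    and "i \<in> {1..n}" "p \<le> a i" "g i = 0" "0 < b i"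
  shows "x i = unexposed_consumption a b p i"
  using nash_equilibrium_consumption[OF assms(1-4)] assms(5,6)
  by (simp add: unexposed_consumption_def field_simps)

lemma peer_pair_consumption:
  fixes \<gamma> b b' w v :: real
  assumes x: "2 * (b + \<gamma>) * x = A + \<gamma> * (w * x' + S)"
    and x': "2 * (b' + \<gamma>) * x' = A' + \<gamma> * (v * x + S')"
    and "0 < b" "0 < b'" "0 < \<gamma>" "0 \<le> w" "w \<le> 1" "0 \<le> v" "v \<le> 1"
    and E: "0 < 4 * (b' + \<gamma>) * S + 2 * w * (A' + \<gamma> * S')" (is "0 < ?E")
  shows "x \<le> A / (2 * b) \<longleftrightarrow> b \<le> A * (4 * (b' + \<gamma>) - \<gamma> * w * v) / ?E" (is ?le)
    and "x < A / (2 * b) \<longleftrightarrow> b < A * (4 * (b' + \<gamma>) - \<gamma> * w * v) / ?E" (is ?less)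
proof -
  define D where "D = 4 * (b + \<gamma>) * (b' + \<gamma>) - \<gamma>\<^sup>2 * w * v"
  define N where "N = A * (4 * (b' + \<gamma>) - \<gamma> * w * v)"
  \<comment> \<open>Bounded influences and \<open>b, b' > 0\<close> make the diagonal product
    dominate the determinant.\<close>
  have "w * v \<le> 1 * 1"
    using assms by (intro mult_mono) auto
  then have "\<gamma>\<^sup>2 * w * v \<le> \<gamma>\<^sup>2"
    using mult_left_mono[of "w * v" 1 "\<gamma>\<^sup>2"] by (simp add: mult.assoc)
  moreover have "\<gamma>\<^sup>2 < (b + \<gamma>) * (b' + \<gamma>)"
    unfolding power2_eq_square using assms by (intro mult_strict_mono) auto
  ultimately have D: "0 < D"
    unfolding D_def using zero_le_power2[of \<gamma>] by linarith
  \<comment> \<open>Multiply the first equation by \<open>2 * (b' + \<gamma>)\<close> and substitute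
    the second for \<open>x'\<close>.\<close>
  have "D * x = 2 * (b' + \<gamma>) * (A + \<gamma> * S) + \<gamma> * w * (A' + \<gamma> * S')"
    unfolding D_def using x x' by algebra
  \<comment> \<open>The terms \<open>4 * b * (b' + \<gamma>) * A\<close> cancel, and every remaining
    term carries a factor \<open>\<gamma>\<close>.\<close>
  then have key: "D * (A - 2 * b * x) = \<gamma> * (N - b * ?E)"
    unfolding D_def N_def by algebra
  have "x \<le> A / (2 * b) \<longleftrightarrow> 0 \<le> D * (A - 2 * b * x)"
    using D \<open>0 < b\<close> by (simp add: zero_le_mult_iff field_simps)
  also have "\<dots> \<longleftrightarrow> b \<le> N / ?E"
    unfolding key using E \<open>0 < \<gamma>\<close> by (simp add: zero_le_mult_iff pos_le_divide_eq)
  finally show ?le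
    unfolding N_def .
  have "x < A / (2 * b) \<longleftrightarrow> 0 < D * (A - 2 * b * x)"
    using D \<open>0 < b\<close> by (simp add: zero_less_mult_iff field_simps)
  also have "\<dots> \<longleftrightarrow> b < N / ?E"
    unfolding key using E \<open>0 < \<gamma>\<close> by (simp add: zero_less_mult_iff pos_less_divide_eq)
  finally show ?less
    unfolding N_def .
qed

text \<open>Since the row sums are positive, an exposed user is influenced by the other exposed user or by
  an unexposed one; hence the bounds have no zero denominator.\<close>

lemma exposure_bound_denominator_pos:
  fixes u :: "nat \<Rightarrow> real"
  assumes W: "\<And>j. j \<in> {3..n} \<Longrightarrow> 0 \<le> W i j" "0 \<le> W i k"
    and row: "W i k + (\<Sum>j=3..n. W i j) = (1::real)"
    and u: "\<And>j. j \<in> {3..n} \<Longrightarrow> 0 < u j" and "0 < d" "0 < e"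
  shows "0 < d * (\<Sum>j=3..n. W i j * u j) + 2 * W i k * e"
proof -
  have nonneg: "0 \<le> (\<Sum>j=3..n. W i j * u j)"
    using W u by (intro sum_nonneg mult_nonneg_nonneg) (auto intro: less_imp_le)
  show ?thesis
  proof (cases "W i k = 0")
    case True
    then have "\<exists>j\<in>{3..n}. W i j \<noteq> 0"
      using row sum.neutral[of "{3..n}" "W i"] by (metis add_0 zero_neq_one)
    then obtain j where j: "j \<in> {3..n}" "W i j \<noteq> 0"
      by blast
    then have "0 < W i j * u j"
      using W(1)[OF j(1)] u[OF j(1)] by simp
    then have "0 < (\<Sum>j=3..n. W i j * u j)"
      using W u by (intro sum_pos2[OF _ j(1)] mult_nonneg_nonneg) (auto intro: less_imp_le)
    then show ?thesis
      using True \<open>0 < d\<close> by simp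
  next
    case False
    then show ?thesis
      using W nonneg \<open>0 < d\<close> \<open>0 < e\<close> by (intro add_nonneg_pos) auto
  qed
qed

theorem theorem8:
  fixes n :: nat and W :: "nat \<Rightarrow> nat \<Rightarrow> real" and a b x :: "nat \<Rightarrow> real" and p \<gamma> :: real
  assumes "n \<ge> 2"
    and "interaction_matrix n W"
    and "connected_users W 1 2"
    and "\<gamma> \<ge> 0"
    and "\<forall>i\<in>{1..n}. a i > p \<and> b i > exposure {1, 2} \<gamma> i"
    and "nash_equilibrium n W a b p (exposure {1, 2} \<gamma>) x"
  shows
    "(b 1 \<le> exposure_bound n W a b p \<gamma> 1 2 \<and> b 2 \<le> exposure_bound n W a b p \<gamma> 2 1 \<longrightarrow>
        x 1 + x 2 \<le> (a 1 - p) / (2 * b 1) + (a 2 - p) / (2 * b 2) \<and>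
        (\<gamma> > 0 \<and> (n = 2 \<or> b 1 < exposure_bound n W a b p \<gamma> 1 2 \<or> b 2 < exposure_bound n W a b p \<gamma> 2 1) \<longrightarrow>
           x 1 + x 2 < (a 1 - p) / (2 * b 1) + (a 2 - p) / (2 * b 2))) \<and>
     (n = 2 \<longrightarrow>
        (b 1 \<le> exposure_bound n W a b p \<gamma> 1 2 \<longleftrightarrow>
           b 1 \<le> (a 1 - p) * (4 * b 2 + 3 * \<gamma>) / (2 * (a 2 - p))) \<and>
        (b 2 \<le> exposure_bound n W a b p \<gamma> 2 1 \<longleftrightarrow>
           b 2 \<le> (a 2 - p) * (4 * b 1 + 3 * \<gamma>) / (2 * (a 1 - p))))"
proof -
  let ?g = "exposure {1, 2} \<gamma>"
  let ?u = "unexposed_consumption a b p"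
  define S where "S i = (\<Sum>j=3..n. W i j * ?u j)" for i
  note W = assms(2) and nash = assms(6)
  have split: "(\<Sum>k=1..n. f k) = f 1 + f 2 + (\<Sum>k=3..n. f k)" for f :: "nat \<Rightarrow> real"
    using \<open>n \<ge> 2\<close> by (simp add: sum.atLeast_Suc_atMost numeral_eq_Suc)
  have g: "?g 1 = \<gamma>" "?g 2 = \<gamma>" "\<And>j. j \<in> {3..n} \<Longrightarrow> ?g j = 0"
    by (auto simp: exposure_def)
  have A: "p < a i" if "i \<in> {1..n}" for i
    using assms(5) that by blast
  have in12: "1 \<in> {1..n}" "2 \<in> {1..n}"
    using \<open>n \<ge> 2\<close> by auto
  have b12: "0 < b 1" "0 < b 2"
    using assms(4) bspec[OF assms(5) in12(1)] bspec[OF assms(5) in12(2)] g by auto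
  have W01: "0 \<le> W i j" "W i j \<le> 1" if "i \<in> {1..n}" "j \<in> {1..n}" for i j
    using W that by (auto simp: interaction_matrix_def)
  have diag: "W 1 1 = 0" "W 2 2 = 0"
    using W in12 by (auto simp: interaction_matrix_def)
  have row: "W 1 2 + (\<Sum>j=3..n. W 1 j) = 1" "W 2 1 + (\<Sum>j=3..n. W 2 j) = 1"
    using W in12 diag split[of "W 1"] split[of "W 2"] by (auto simp: interaction_matrix_def)
  have bj: "0 < b j" if "j \<in> {3..n}" for j
    using bspec[OF assms(5), of j] g(3)[OF that] that by auto
  have u: "0 < ?u j" if "j \<in> {3..n}" for j
    using A[of j] bj[OF that] that by (simp add: unexposed_consumption_def)
  \<comment> \<open>Unexposed users do not react to users 1 and 2, so \<open>S 1\<close> and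
    \<open>S 2\<close> are constants and the system for \<open>x 1\<close>, \<open>x 2\<close>
    closes.\<close>
  have xu: "x j = ?u j" if "j \<in> {3..n}" for j
    using unexposed_equilibrium_consumption[OF W nash] A[of j] bj g(3) that by force
  have S: "(\<Sum>k=3..n. W i k * x k) = S i" for i
    unfolding S_def using xu by (intro sum.cong) auto
  have S0: "0 \<le> S 1" "0 \<le> S 2"
    unfolding S_def using W01 in12 less_imp_le[OF u]
    by (auto intro!: sum_nonneg mult_nonneg_nonneg)
  have x1: "2 * (b 1 + \<gamma>) * x 1 = a 1 - p + \<gamma> * (W 1 2 * x 2 + S 1)"
    using nash_equilibrium_consumption[OF W nash in12(1), unfolded g split S diag]
      A[OF in12(1)] b12 assms(4) by simp
  have x2: "2 * (b 2 + \<gamma>) * x 2 = a 2 - p + \<gamma> * (W 2 1 * x 1 + S 2)"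
    using nash_equilibrium_consumption[OF W nash in12(2), unfolded g split S diag]
      A[OF in12(2)] b12 assms(4) by simp
  have E1: "0 < 4 * (b 2 + \<gamma>) * S 1 + 2 * W 1 2 * (a 2 - p + \<gamma> * S 2)"
    unfolding S_def[of 1] using W01 in12 u row A[OF in12(2)] S0 b12 assms(4)
    by (intro exposure_bound_denominator_pos) (auto intro: add_pos_nonneg)
  have E2: "0 < 4 * (b 1 + \<gamma>) * S 2 + 2 * W 2 1 * (a 1 - p + \<gamma> * S 1)"
    unfolding S_def[of 2] using W01 in12 u row A[OF in12(1)] S0 b12 assms(4)
    by (intro exposure_bound_denominator_pos) (auto intro: add_pos_nonneg)
  \<comment> \<open>The pair lemma is used twice, the second time with the two users
    interchanged.\<close>
  have bound_iffs:
    "x 1 \<le> (a 1 - p) / (2 * b 1) \<longleftrightarrow> b 1 \<le> exposure_bound n W a b p \<gamma> 1 2"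
    "x 1 < (a 1 - p) / (2 * b 1) \<longleftrightarrow> b 1 < exposure_bound n W a b p \<gamma> 1 2"
    "x 2 \<le> (a 2 - p) / (2 * b 2) \<longleftrightarrow> b 2 \<le> exposure_bound n W a b p \<gamma> 2 1"
    "x 2 < (a 2 - p) / (2 * b 2) \<longleftrightarrow> b 2 < exposure_bound n W a b p \<gamma> 2 1"
    if "0 < \<gamma>"
    unfolding exposure_bound_def S_def[symmetric]
    using peer_pair_consumption[OF x1 x2 b12 that _ _ _ _ E1] in12 W01
      peer_pair_consumption[OF x2 x1 b12(2,1) that _ _ _ _ E2] by auto
  \<comment> \<open>The sums over \<open>{3..n}\<close> are empty, so the row sums force
    \<open>W 1 2 = W 2 1 = 1\<close>, and \<open>4 * (b k + \<gamma>) - \<gamma>\<close> becomes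
    \<open>4 * b k + 3 * \<gamma>\<close>.\<close>
  have two:
    "exposure_bound n W a b p \<gamma> 1 2 = (a 1 - p) * (4 * b 2 + 3 * \<gamma>) / (2 * (a 2 - p))"
    "exposure_bound n W a b p \<gamma> 2 1 = (a 2 - p) * (4 * b 1 + 3 * \<gamma>) / (2 * (a 1 - p))"
    if "n = 2"
    using row that by (simp_all add: exposure_bound_def algebra_simps)
  have not_both_equal:
    "b 1 < exposure_bound n W a b p \<gamma> 1 2 \<or> b 2 < exposure_bound n W a b p \<gamma> 2 1"
    if "n = 2" and le: "b 1 \<le> exposure_bound n W a b p \<gamma> 1 2" "b 2 \<le> exposure_bound n W a b p \<gamma> 2 1"
  proof (rule ccontr)
    assume "\<not> ?thesis"
    with le have "b 1 * (2 * (a 2 - p)) = (a 1 - p) * (4 * b 2 + 3 * \<gamma>)"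
      "b 2 * (2 * (a 1 - p)) = (a 2 - p) * (4 * b 1 + 3 * \<gamma>)"
      unfolding two[OF \<open>n = 2\<close>] using A[OF in12(1)] A[OF in12(2)] by (auto simp: eq_divide_eq)
    \<comment> \<open>Adding the two cross-multiplied equalities leaves a sum of positive and
      nonnegative terms equal to zero.\<close>
    then have "2 * (b 1 * (a 2 - p)) + 2 * (b 2 * (a 1 - p)) + 3 * ((a 1 - p + (a 2 - p)) * \<gamma>) = 0"
      by algebra
    moreover have "0 < b 1 * (a 2 - p)" "0 < b 2 * (a 1 - p)" "0 \<le> (a 1 - p + (a 2 - p)) * \<gamma>"
      using A[OF in12(1)] A[OF in12(2)] b12 assms(4) by auto
    ultimately show False
      by linarith
  qed
  \<comment> \<open>For \<open>\<gamma> = 0\<close> the factor \<open>\<gamma>\<close> in the key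
    identity carries no information, but both consumptions keep their unexposed values and the weak
    inequality is an equality.\<close>
  have unexposed: "x 1 = (a 1 - p) / (2 * b 1)" "x 2 = (a 2 - p) / (2 * b 2)" if "\<gamma> = 0"
    using x1 x2 b12 that by (simp_all add: field_simps)
  show ?thesis
  proof (intro conjI impI)
    assume le: "b 1 \<le> exposure_bound n W a b p \<gamma> 1 2 \<and> b 2 \<le> exposure_bound n W a b p \<gamma> 2 1"
    show "x 1 + x 2 \<le> (a 1 - p) / (2 * b 1) + (a 2 - p) / (2 * b 2)"
    proof (cases "\<gamma> = 0")
      case False
      with assms(4) have "0 < \<gamma>" by simp
      then show ?thesis
        using le bound_iffs by (intro add_mono) auto
    qed (use unexposed in simp)
    assume strict: "\<gamma> > 0 \<and> (n = 2 \<or> b 1 < exposure_bound n W a b p \<gamma> 1 2 \<or>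
      b 2 < exposure_bound n W a b p \<gamma> 2 1)"
    then have "0 < \<gamma>" by blast
    \<comment> \<open>One strict bound suffices: that user consumes strictly less and the other no
      more.\<close>
    moreover have "b 1 < exposure_bound n W a b p \<gamma> 1 2 \<or> b 2 < exposure_bound n W a b p \<gamma> 2 1"
      using strict not_both_equal le by blast
    ultimately show "x 1 + x 2 < (a 1 - p) / (2 * b 1) + (a 2 - p) / (2 * b 2)"
      using le bound_iffs by (meson add_le_less_mono add_less_le_mono)
  qed (metis two(1), metis two(2))
qed

end
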